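(* For $n\ge 2$, the probability that the labels of the bottom row of a random continuous multiline queue of type $(1,\dots,1)$, read in increasing order of position in $[0,1)$, form the reverse permutation $w_0=n(n-1)\cdots 21$ is \[p_{w_0}=\frac{1}{\prod_{k=1}^{n-1}\binom{2k+1}{k+1}}.\]
   Context: A continuous multiline queue of type $(1,\dots,1)$ has $n$ rows indexed $1,\dots,n$ from top to bottom; row $i$ contains $i$ boxes at positions in $[0,1)$ (viewed as a circle), all $\binom{n+1}{2}$ positions chosen independently and uniformly at random. Boxes are labelled row by row: the box in row $1$ gets label $1$; once row $i$ is labelled, go through its boxes in order of increasing label; a box with label $k$ at position $c$ gives label $k$ to the first still-unlabelled box of row $i+1$ at position weakly to the right of $c$, going cyclically around $[0,1)$; the remaining unlabelled box of row $i+1$ gets label $i+1$. (Coincident positions have probability zero.) *)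

theory Defs
  imports "HOL-Probability.Probability"
begin

text \<open>Box (i, j) with 1 \<le> j \<le> i \<le> n is the j-th box of row i; the numbering of the boxes inside a
  row is arbitrary and unrelated to their positions.  A configuration x maps boxes to positions.\<close>

definition boxes :: "nat \<Rightarrow> (nat \<times> nat) set" where
  "boxes n = {(i, j). 1 \<le> j \<and> j \<le> i \<and> i \<le> n}"

definition random_mlq :: "nat \<Rightarrow> (nat \<times> nat \<Rightarrow> real) measure" where
  "random_mlq n = (\<Pi>\<^sub>M b\<in>boxes n. uniform_measure lborel {0..<1})"

text \<open>On the circle [0,1), the distance travelled from c to y going right is frac (y - c), so
  the first box weakly to the right of c is the one minimising it.\<close>

lemma frac_diff_unit_interval:
  fixes c y :: real
  assumes "c \<in> {0..<1}" "y \<in> {0..<1}"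
  shows "frac (y - c) = (if c \<le> y then y - c else y + 1 - c)"
  using assms by (auto simp: frac_unique_iff intro: Ints_1 Ints_minus)

definition first_right :: "(nat \<Rightarrow> real) \<Rightarrow> real \<Rightarrow> nat set \<Rightarrow> nat" where
  "first_right y c U = arg_min_on (\<lambda>j. frac (y j - c)) U"

text \<open>One labelling step: y gives the positions of the boxes of the row being labelled, the list
  holds the positions of the boxes of the row above in order of increasing label, and U is the set
  of still-unlabelled boxes.  The result lists the boxes of the new row by increasing label.\<close>

fun label_row :: "(nat \<Rightarrow> real) \<Rightarrow> real list \<Rightarrow> nat set \<Rightarrow> nat list" where
  "label_row y [] U = [the_elem U]"
| "label_row y (c # cs) U =
     first_right y c U # label_row y cs (U - {first_right y c U})"

text \<open>The boxes of row i by increasing label.  Row 1 is labelled from the empty row 0, so that its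
  only box gets label 1.\<close>

fun boxes_by_label :: "(nat \<times> nat \<Rightarrow> real) \<Rightarrow> nat \<Rightarrow> nat list" where
  "boxes_by_label x 0 = []"
| "boxes_by_label x (Suc i) =
     label_row (\<lambda>j. x (Suc i, j)) (map (\<lambda>j. x (i, j)) (boxes_by_label x i)) {1..Suc i}"

definition label_position :: "(nat \<times> nat \<Rightarrow> real) \<Rightarrow> nat \<Rightarrow> nat \<Rightarrow> real" where
  "label_position x i k = x (i, boxes_by_label x i ! (k - 1))"

definition row_word :: "(nat \<times> nat \<Rightarrow> real) \<Rightarrow> nat \<Rightarrow> nat list" where
  "row_word x i = sort_key (label_position x i) [1..<Suc i]"

lemma prob_space_random_mlq: "prob_space (random_mlq n)"
  unfolding random_mlq_def
  by (intro prob_space_PiM prob_space_uniform_measure) auto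

end

theory Submission
  imports Defs "HOL-Computational_Algebra.Polynomial"
begin

text \<open>
  The bottom word is \<open>w\<^sub>0\<close> iff the positions of the boxes form a Gelfand--Tsetlin pattern: each row
  interlaces with the next one.  In terms of the number \<open>N\<^sub>i(s)\<close> of boxes of row \<open>i\<close> with position at
  most \<open>s\<close>, this means that \<open>N\<^sub>i(s) \<le> N\<^sub>i\<^sub>+\<^sub>1(s) \<le> N\<^sub>i(s) + 1\<close> for all \<open>i\<close> and \<open>s\<close>.  As \<open>s\<close> grows from 0 to
  1 the boxes appear one at a time in uniformly random order, and the vectors satisfying these
  inequalities correspond to strict partitions \<open>\<lambda>\<close>, the final one being the staircase
  \<open>(n, n-1, \<dots>, 1)\<close>.  The probability is therefore the product of the \<open>i!\<close> (orderings of the boxes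
  inside row \<open>i\<close>) times the number of standard shifted tableaux of staircase shape, divided by the
  factorial of the number of boxes.  That number is
  given by the product formula of Schur and Thrall, whose recursion under removal of a corner is an
  instance of Lagrange interpolation at the points \<open>\<lambda>\<^sub>i(\<lambda>\<^sub>i - 1)\<close>.
\<close>

section \<open>Shifted tableaux and Lagrange interpolation\<close>

lemma degree_prod_linear:
  fixes u :: "'a \<Rightarrow> 'b::field"
  shows "finite A \<Longrightarrow> degree (\<Prod>j\<in>A. [:- u j, 1:]) = card A"
  by (subst degree_prod_eq_sum_degree) auto

lemma lead_coeff_prod_linear:
  fixes u :: "'a \<Rightarrow> 'b::field"
  shows "finite A \<Longrightarrow> coeff (\<Prod>j\<in>A. [:- u j, 1:]) (card A) = 1"
  using lead_coeff_prod[of "\<lambda>j. [:- u j, 1:]" A] by (simp add: degree_prod_linear)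

lemma subleading_coeff_prod_linear:
  fixes u :: "'a \<Rightarrow> 'b::field"
  assumes "finite A" "A \<noteq> {}"
  shows "coeff (\<Prod>j\<in>A. [:- u j, 1:]) (card A - 1) = - (\<Sum>j\<in>A. u j)"
  using assms
proof (induction rule: finite_ne_induct)
  case (insert x F)
  then obtain k where k: "card F = Suc k" by (metis card_0_eq not0_implies_Suc)
  show ?case using insert k lead_coeff_prod_linear[of F u] by (simp add: coeff_pCons)
qed simp

text \<open>The interpolation polynomial \<open>q\<close> agrees with \<open>p\<close> at
  \<open>card A\<close> distinct nodes and both have degree below \<open>card A\<close>, so they are
  equal. The left-hand side is the coefficient of \<open>q\<close> at
  \<open>card A - 1\<close>.\<close>

lemma sum_lagrange_weights:
  fixes u :: "'a \<Rightarrow> 'b::field"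
  assumes fin: "finite A" and inj: "inj_on u A" and deg: "degree p < card A"
  shows "(\<Sum>i\<in>A. poly p (u i) / (\<Prod>j\<in>A-{i}. u i - u j)) = coeff p (card A - 1)"
proof -
  define c where "c i = poly p (u i) / (\<Prod>j\<in>A-{i}. u i - u j)" for i
  define q where "q = (\<Sum>i\<in>A. smult (c i) (\<Prod>j\<in>A-{i}. [:- u j, 1:]))"
  have ne: "(\<Prod>j\<in>A-{i}. u i - u j) \<noteq> 0" if "i \<in> A" for i
    using inj that fin by (auto simp: inj_on_def)
  have "degree q \<le> card A - 1"
    unfolding q_def
  proof (rule degree_sum_le[OF fin])
    fix i assume "i \<in> A"
    then show "degree (smult (c i) (\<Prod>j\<in>A-{i}. [:- u j, 1:])) \<le> card A - 1"
      using fin by (intro order.trans[OF degree_smult_le]) (simp add: degree_prod_linear)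
  qed
  then have degq: "degree q < card A" using deg by simp
  have "poly q (u k) = poly p (u k)" if k: "k \<in> A" for k
  proof -
    have "poly q (u k) = (\<Sum>i\<in>A. c i * (\<Prod>j\<in>A-{i}. u k - u j))"
      by (simp add: q_def poly_sum poly_prod)
    also have "\<dots> = (\<Sum>i\<in>{k}. c i * (\<Prod>j\<in>A-{i}. u k - u j))"
      using fin k by (intro sum.mono_neutral_right) auto
    also have "\<dots> = poly p (u k)" using ne[OF k] by (simp add: c_def)
    finally show ?thesis .
  qed
  then have "p = q"
    by (intro poly_eqI_degree[of "u ` A"]) (use deg degq inj in \<open>auto simp: card_image\<close>)
  have "coeff q (card A - 1) = (\<Sum>i\<in>A. c i)"
    unfolding q_def coeff_sum coeff_smult
  proof (rule sum.cong)
    fix i assume "i \<in> A"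
    then show "c i * coeff (\<Prod>j\<in>A-{i}. [:- u j, 1:]) (card A - 1) = c i"
      using fin lead_coeff_prod_linear[of "A-{i}" u] by simp
  qed simp
  then show ?thesis using \<open>p = q\<close> by (simp add: c_def)
qed

text \<open>The monic polynomial with roots \<open>w j\<close> has degree \<open>card A\<close>, one
  too high for interpolation. Subtracting the one with roots \<open>u j\<close> cancels the leading
  term and changes no value at the nodes; the coefficient at \<open>card A - 1\<close> is then given
  by Vieta.\<close>

lemma sum_lagrange_monic:
  fixes u w :: "'a \<Rightarrow> 'b::field"
  assumes fin: "finite A" and inj: "inj_on u A"
  shows "(\<Sum>i\<in>A. (\<Prod>j\<in>A. u i - w j) / (\<Prod>j\<in>A-{i}. u i - u j)) = (\<Sum>j\<in>A. u j - w j)"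
proof (cases "A = {}")
  case False
  define p where "p = (\<Prod>j\<in>A. [:- w j, 1:]) - (\<Prod>j\<in>A. [:- u j, 1:])"
  have pos: "card A > 0" using False fin by (simp add: card_gt_0_iff)
  have "degree p \<le> card A" unfolding p_def
    by (intro degree_diff_le) (simp_all add: degree_prod_linear fin)
  moreover have "coeff p (card A) = 0" by (simp add: p_def lead_coeff_prod_linear fin)
  ultimately have "degree p < card A"
    using pos by (metis le_neq_implies_less degree_0 leading_coeff_0_iff)
  then have "(\<Sum>i\<in>A. poly p (u i) / (\<Prod>j\<in>A-{i}. u i - u j)) = coeff p (card A - 1)"
    by (rule sum_lagrange_weights[OF fin inj])
  moreover have "poly p (u i) = (\<Prod>j\<in>A. u i - w j)" if "i \<in> A" for i
    using that fin by (auto simp: p_def poly_prod)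
  ultimately show ?thesis
    using subleading_coeff_prod_linear[OF fin False, of w] subleading_coeff_prod_linear[OF fin False, of u]
    by (simp add: p_def sum_subtractf del: poly_diff)
qed simp

section \<open>Product weights of strict partitions\<close>

text \<open>For a strict partition with set of parts \<open>L\<close>, the number of standard shifted Young tableaux
  of shape \<open>L\<close> is \<open>(\<Sum>L)! * shifted_weight L\<close>.\<close>

definition shifted_weight :: "nat set \<Rightarrow> real" where
  "shifted_weight L = (\<Prod>b\<in>L. (\<Prod>a\<in>{a\<in>L. a < b}. (real b - real a) / (real a + real b)) / fact b)"

text \<open>The factor of a pair depends on the order of its elements only through a sign, so
  absolute values merge the pairs in which \<open>x\<close> is the larger element with those in
  which it is the smaller.\<close>

lemma shifted_weight_insert:
  assumes "finite K" "x \<notin> K"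
  shows "shifted_weight (insert x K) =
    shifted_weight K * (\<Prod>a\<in>K. \<bar>real x - real a\<bar> / (real x + real a)) / fact x"
proof -
  let ?g = "\<lambda>a b. (real b - real a) / (real a + real b)"
  have lt: "{a \<in> insert x K. a < b} = (if x < b then insert x {a\<in>K. a < b} else {a\<in>K. a < b})" for b
    by auto
  have "(\<Prod>b\<in>K. (\<Prod>a\<in>{a\<in>insert x K. a < b}. ?g a b) / fact b) =
      (\<Prod>b\<in>K. (if x < b then ?g x b else 1) * ((\<Prod>a\<in>{a\<in>K. a < b}. ?g a b) / fact b))"
    unfolding lt using assms by (intro prod.cong) auto
  also have "\<dots> = (\<Prod>b\<in>K. if x < b then ?g x b else 1) * shifted_weight K"
    by (simp only: prod.distrib shifted_weight_def)
  finally have 1: "(\<Prod>b\<in>K. (\<Prod>a\<in>{a\<in>insert x K. a < b}. ?g a b) / fact b) =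
    (\<Prod>b\<in>K. if x < b then ?g x b else 1) * shifted_weight K" .
  have 2: "(\<Prod>a\<in>{a\<in>insert x K. a < x}. ?g a x) = (\<Prod>a\<in>K. if a < x then ?g a x else 1)"
    unfolding lt using assms by (simp add: prod.inter_filter)
  have "(\<Prod>a\<in>K. if a < x then ?g a x else 1) * (\<Prod>b\<in>K. if x < b then ?g x b else 1)
      = (\<Prod>a\<in>K. \<bar>real x - real a\<bar> / (real x + real a))"
    unfolding prod.distrib[symmetric]
    using assms by (intro prod.cong) (auto simp: add.commute)
  then show ?thesis
    unfolding shifted_weight_def[of "insert x K"] prod.insert[OF assms] 1 2
    by (simp add: mult_ac)
qed

lemma shifted_weight_nonneg: "shifted_weight L \<ge> 0"
  unfolding shifted_weight_def by (intro prod_nonneg ballI divide_nonneg_nonneg) auto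

text \<open>Pairs containing 0 contribute 1, and so does \<open>fact 0\<close>. Hence a part 1 that
  drops to 0 can be treated like any other decrease.\<close>

lemma shifted_weight_remove_0:
  assumes "finite L" shows "shifted_weight (L - {0}) = shifted_weight L"
proof (cases "0 \<in> L")
  case True
  then have L: "L = insert 0 (L - {0})" by auto
  have "(\<Prod>a\<in>L-{0}. \<bar>real 0 - real a\<bar> / (real 0 + real a)) = 1"
    by (intro prod.neutral) auto
  with shifted_weight_insert[of "L-{0}" 0] assms L show ?thesis by simp
qed simp

text \<open>Both sets arise from \<open>L - {l}\<close> by inserting one element, so the ratio is a
  product over the other parts. It is written in a form that vanishes when \<open>l - 1\<close> is a
  part, which the summation over all of \<open>L\<close> exploits.\<close>

lemma shifted_weight_decrease:
  assumes L: "finite L" "0 \<notin> L" and l: "l \<in> L" "l - 1 \<notin> L"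
  shows "shifted_weight (insert (l - 1) (L - {l})) = shifted_weight L * (real l *
    (\<Prod>j\<in>L-{l}. (real l - 1 - real j) * (real l + real j) / ((real l - real j) * (real l + real j - 1))))"
proof -
  let ?K = "L - {l}"
  have l0: "l > 0" using L l by (metis gr0I)
  have L': "L = insert l ?K" using l by auto
  have fl: "fact l = real l * fact (l - 1)" using l0 by (simp add: fact_reduce)
  have rl: "real (l - 1) = real l - 1" using l0 by simp
  have fac: "\<bar>real (l-1) - real j\<bar> / (real (l-1) + real j) =
     \<bar>real l - real j\<bar> / (real l + real j) * ((real l - 1 - real j) * (real l + real j) / ((real l - real j) * (real l + real j - 1)))"
    if "j \<in> ?K" for j
  proof -
    have "j \<noteq> l" using that by auto
    \<comment> \<open>No integer lies strictly between \<open>l - 1\<close> and \<open>l\<close>, so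
      the two differences never have opposite signs.\<close>
    then have e: "\<bar>real l - 1 - real j\<bar> = \<bar>real l - real j\<bar> * ((real l - 1 - real j) / (real l - real j))"
      by (cases "j < l") (auto simp: abs_if field_simps)
    have "real l + real j \<noteq> 0" using l0 by simp
    then have "\<bar>real l - real j\<bar> * ((real l - 1 - real j) / (real l - real j)) / (real l + real j - 1) =
      \<bar>real l - real j\<bar> / (real l + real j) * ((real l - 1 - real j) * (real l + real j) / ((real l - real j) * (real l + real j - 1)))"
      by simp
    then show ?thesis unfolding rl e by (simp add: algebra_simps)
  qed
  have "shifted_weight (insert (l - 1) ?K) =
      shifted_weight ?K * (\<Prod>j\<in>?K. \<bar>real (l-1) - real j\<bar> / (real (l-1) + real j)) / fact (l - 1)"
    using L l by (intro shifted_weight_insert) auto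
  also have "(\<Prod>j\<in>?K. \<bar>real (l-1) - real j\<bar> / (real (l-1) + real j)) =
     (\<Prod>j\<in>?K. \<bar>real l - real j\<bar> / (real l + real j)) *
     (\<Prod>j\<in>?K. (real l - 1 - real j) * (real l + real j) / ((real l - real j) * (real l + real j - 1)))"
    unfolding prod.distrib[symmetric] by (intro prod.cong refl fac)
  finally show ?thesis
    using shifted_weight_insert[of ?K l] L L' l0 fl by simp
qed

text \<open>This is the tableau recursion: the largest entry of a standard shifted tableau occupies
  a removable corner, and deleting it lowers a part \<open>l\<close> for which \<open>l - 1\<close>
  is not a part.\<close>

lemma sum_shifted_weight_decrease:
  assumes L: "finite L" "0 \<notin> L"
  shows "(\<Sum>l\<in>{l\<in>L. l - 1 \<notin> L}. shifted_weight (insert (l - 1) (L - {l}))) = real (\<Sum>L) * shifted_weight L"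
proof -
  \<comment> \<open>With this \<open>u\<close> and \<open>w\<close> the factors of \<open>T\<close> below become \<open>(u l - w j) / (u l - u j)\<close>, and
    \<open>real l = - (u l - w l) / 2\<close>, so that Lagrange interpolation applies.\<close>
  define u where "u j = real j * (real j - 1)" for j
  define w where "w j = real j * (real j + 1)" for j
  define T where "T l = real l * (\<Prod>j\<in>L-{l}. (real l - 1 - real j) * (real l + real j) / ((real l - real j) * (real l + real j - 1)))" for l
  have inj: "inj_on u L"
  proof (rule inj_onI)
    fix a b assume ab: "a \<in> L" "b \<in> L" "u a = u b"
    have "a > 0" "b > 0" using L ab by (metis gr0I)+
    moreover have "(real a - real b) * (real a + real b - 1) = 0"
      using ab by (simp add: u_def algebra_simps)
    ultimately show "a = b" by auto
  qed
  have T: "T l = - (1/2) * ((\<Prod>j\<in>L. u l - w j) / (\<Prod>j\<in>L-{l}. u l - u j))" if "l \<in> L" for l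
  proof -
    have "(\<Prod>j\<in>L. u l - w j) = (u l - w l) * (\<Prod>j\<in>L-{l}. u l - w j)"
      using that L by (simp add: prod.remove)
    moreover have "u l - w l = - 2 * real l" by (simp add: u_def w_def algebra_simps)
    moreover have "(\<Prod>j\<in>L-{l}. (real l - 1 - real j) * (real l + real j) / ((real l - real j) * (real l + real j - 1)))
       = (\<Prod>j\<in>L-{l}. u l - w j) / (\<Prod>j\<in>L-{l}. u l - u j)"
      unfolding prod_dividef[symmetric]
      by (intro prod.cong refl arg_cong2[of _ _ _ _ "(/)"]) (simp_all add: u_def w_def algebra_simps)
    ultimately show ?thesis by (simp add: T_def)
  qed
  \<comment> \<open>The factor for \<open>j = l - 1\<close> vanishes, so the sum over removable
    corners extends to all of \<open>L\<close>, as interpolation requires.\<close>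
  have T0: "T l = 0" if "l \<in> L" "l - 1 \<in> L" for l
  proof -
    have "l > 0" using that L by (metis gr0I)
    then have "l - 1 \<in> L - {l}" "real l - 1 - real (l - 1) = 0" using that by auto
    then have "\<exists>j\<in>L-{l}. (real l - 1 - real j) * (real l + real j) / ((real l - real j) * (real l + real j - 1)) = 0"
      by (intro bexI[of _ "l - 1"]) (simp_all only: mult_zero_left div_0)
    with L(1) show ?thesis by (simp add: T_def prod_zero)
  qed
  have "(\<Sum>l\<in>{l\<in>L. l - 1 \<notin> L}. shifted_weight (insert (l - 1) (L - {l})))
      = (\<Sum>l\<in>{l\<in>L. l - 1 \<notin> L}. shifted_weight L * T l)"
    unfolding T_def by (intro sum.cong refl shifted_weight_decrease[OF L]) auto
  also have "\<dots> = (\<Sum>l\<in>L. shifted_weight L * T l)"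
    using L T0 by (intro sum.mono_neutral_left) auto
  also have "\<dots> = shifted_weight L * (\<Sum>l\<in>L. - (1/2) * ((\<Prod>j\<in>L. u l - w j) / (\<Prod>j\<in>L-{l}. u l - u j)))"
    unfolding sum_distrib_left by (intro sum.cong refl) (simp only: T)
  also have "(\<Sum>l\<in>L. - (1/2) * ((\<Prod>j\<in>L. u l - w j) / (\<Prod>j\<in>L-{l}. u l - u j))) = - (1/2) * (\<Sum>j\<in>L. u j - w j)"
    unfolding sum_distrib_left[symmetric] by (simp only: sum_lagrange_monic[OF L(1) inj])
  also have "\<dots> = (\<Sum>j\<in>L. real j)"
    unfolding sum_distrib_left by (intro sum.cong) (auto simp: u_def w_def algebra_simps)
  finally show ?thesis by simp
qed

text \<open>Adding the part \<open>Suc n\<close> multiplies the weight by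
  \<open>fact n / fact (2 * n + 1)\<close>; together with the new factor \<open>fact (Suc n)\<close>
  this is the reciprocal of one binomial coefficient.\<close>

lemma shifted_weight_staircase:
  "(\<Prod>i=1..n. fact i) * shifted_weight {1..n} = 1 / (\<Prod>k=1..n-1. real ((2 * k + 1) choose (k + 1)))"
proof (induction n)
  case 0
  then show ?case by (simp add: shifted_weight_def)
next
  case (Suc n)
  have e: "(\<Prod>a\<in>{1..n}. \<bar>real (Suc n) - real a\<bar>) = fact n"
  proof -
    have "(\<Prod>a\<in>{1..n}. \<bar>real (Suc n) - real a\<bar>) = (\<Prod>a\<in>{1..n}. real (Suc n - a))"
      by (intro prod.cong) auto
    also have "\<dots> = (\<Prod>a\<in>{1..n}. real a)"
      by (rule prod.reindex_bij_witness[of _ "\<lambda>a. Suc n - a" "\<lambda>a. Suc n - a"]) auto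
    finally show ?thesis by (simp add: fact_prod)
  qed
  have d: "(\<Prod>a\<in>{1..n}. real (Suc n) + real a) * fact (Suc n) = fact (2 * n + 1)"
  proof -
    \<comment> \<open>The upper limit is separated from the \<open>n\<close> inside the factors to
      allow an induction.\<close>
    have "(\<Prod>a\<in>{1..m}. real (Suc n) + real a) * fact (Suc n) = fact (Suc n + m)" for m
      by (induction m) (auto simp: algebra_simps)
    moreover have "Suc n + n = 2 * n + 1" by simp
    ultimately show ?thesis by metis
  qed
  have ch: "real ((2 * n + 1) choose (n + 1)) = fact (2 * n + 1) / (fact (n + 1) * fact n)"
    by (subst binomial_fact) auto
  have ins: "{1..Suc n} = insert (Suc n) {1..n}" by auto
  have "shifted_weight {1..Suc n} = shifted_weight {1..n} *
      ((\<Prod>a\<in>{1..n}. \<bar>real (Suc n) - real a\<bar>) / (\<Prod>a\<in>{1..n}. real (Suc n) + real a)) / fact (Suc n)"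
    unfolding ins by (subst shifted_weight_insert) (auto simp: prod_dividef)
  also have "\<dots> = shifted_weight {1..n} * (fact n / fact (2 * n + 1))"
    unfolding e using d by (simp add: field_simps)
  finally have s: "shifted_weight {1..Suc n} = shifted_weight {1..n} * (fact n / fact (2 * n + 1))" .
  have "(\<Prod>i=1..Suc n. fact i) * shifted_weight {1..Suc n} =
     ((\<Prod>i=1..n. fact i) * shifted_weight {1..n}) * (fact (n + 1) * fact n / fact (2 * n + 1))"
    unfolding s by (simp add: mult_ac)
  also have "\<dots> = 1 / ((\<Prod>k=1..n-1. real ((2 * k + 1) choose (k + 1))) * real ((2 * n + 1) choose (n + 1)))"
    unfolding Suc.IH ch by simp
  also have "(\<Prod>k=1..n-1. real ((2 * k + 1) choose (k + 1))) * real ((2 * n + 1) choose (n + 1)) =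
     (\<Prod>k=1..Suc n-1. real ((2 * k + 1) choose (k + 1)))"
    \<comment> \<open>For \<open>n = 0\<close> the extra binomial is 1 and both products are
      empty.\<close>
    by (cases n) (simp_all only: prod.nat_ivl_Suc' diff_Suc_1, simp_all add: mult_ac)
  finally show ?case .
qed

section \<open>Random growth of a set\<close>

abbreviation unif :: "real measure" where "unif \<equiv> uniform_measure lborel {0..<1}"

lemma prob_space_unif: "prob_space unif"
  by (intro prob_space_uniform_measure) auto

lemma nn_integral_unif_power:
  assumes "0 \<le> t" "t \<le> 1"
  shows "(\<integral>\<^sup>+s. ennreal (s ^ k) * indicator {0..<t} s \<partial>unif) = ennreal (t ^ Suc k / Suc k)"
proof -
  have "(\<integral>\<^sup>+s. ennreal (s ^ k) * indicator {0..<t} s \<partial>unif) =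
      (\<integral>\<^sup>+s. ennreal (s ^ k) * indicator {0..<t} s * indicator {0..<1} s \<partial>lborel)"
    by (subst nn_integral_uniform_measure) (auto simp: divide_ennreal_def)
  also have "\<dots> = (\<integral>\<^sup>+s. ennreal (s ^ k) * indicator {0..t} s \<partial>lborel)"
    using assms by (intro nn_integral_cong_AE AE_I[where N="{t}"]) (auto split: split_indicator)
  also have "\<dots> = ennreal (t ^ Suc k / Suc k - 0 ^ Suc k / Suc k)"
    using assms
    by (intro nn_integral_FTC_Icc) (auto intro!: derivative_eq_intros simp: has_real_derivative_iff_has_vector_derivative[symmetric] simp del: power_Suc)
  finally show ?thesis by simp
qed

text \<open>Scanning positions from the left adds the elements of \<open>B\<close> one at a time,
  and \<open>G\<close> is tested after each arrival. The bound \<open>t\<close> is a parameter so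
  that one can condition on the last arrival.\<close>

definition growth_event :: "('a set \<Rightarrow> bool) \<Rightarrow> 'a set \<Rightarrow> real \<Rightarrow> ('a \<Rightarrow> real) set" where
  "growth_event G B t = {x \<in> space (\<Pi>\<^sub>M b\<in>B. unif). (\<forall>b\<in>B. 0 \<le> x b \<and> x b < t) \<and>
     (\<forall>a\<in>B. \<forall>b\<in>B. a \<noteq> b \<longrightarrow> x a \<noteq> x b) \<and> (\<forall>a\<in>B. G {b\<in>B. x b \<le> x a})}"

text \<open>Since \<open>G\<close> is arbitrary, measurability comes from finiteness: the set tested
  is one of finitely many subsets \<open>S\<close>, each singled out by finitely many comparisons of
  coordinates.\<close>

lemma sets_growth_event:
  assumes "finite B"
  shows "growth_event G B t \<in> sets (\<Pi>\<^sub>M b\<in>B. unif)"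
proof -
  have comp: "(\<lambda>x. x b) \<in> borel_measurable (\<Pi>\<^sub>M b\<in>B. unif)" if "b \<in> B" for b
    using measurable_component_singleton[OF that, of "\<lambda>_. unif"] by (simp cong: measurable_cong_sets)
  let ?Q = "\<lambda>x a S. (\<forall>b\<in>S. x b \<le> x a) \<and> (\<forall>b\<in>B-S. x a < x b)"
  have G: "G {b\<in>B. x b \<le> x a} \<longleftrightarrow> (\<exists>S\<in>{S. S \<subseteq> B \<and> G S}. ?Q x a S)" for x :: "'a \<Rightarrow> real" and a
  proof
    assume "G {b\<in>B. x b \<le> x a}"
    then show "\<exists>S\<in>{S. S \<subseteq> B \<and> G S}. ?Q x a S"
      by (intro bexI[of _ "{b\<in>B. x b \<le> x a}"]) auto
  next
    assume "\<exists>S\<in>{S. S \<subseteq> B \<and> G S}. ?Q x a S"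
    then obtain S where "S \<in> {S. S \<subseteq> B \<and> G S}" "?Q x a S" by (rule bexE)
    then have S: "S \<subseteq> B" "G S" "\<And>b. b \<in> S \<Longrightarrow> x b \<le> x a" "\<And>b. b \<in> B - S \<Longrightarrow> x a < x b"
      by blast+
    have "b \<in> S \<longleftrightarrow> b \<in> B \<and> x b \<le> x a" for b
      using S(1) S(3)[of b] S(4)[of b] by (cases "b \<in> S") auto
    then have "S = {b\<in>B. x b \<le> x a}" by blast
    with S(2) show "G {b\<in>B. x b \<le> x a}" by simp
  qed
  have fin: "finite {S. S \<subseteq> B \<and> G S}" "\<And>S. S \<in> {S. S \<subseteq> B \<and> G S} \<Longrightarrow> finite S"
    using assms finite_subset by auto
  have le: "Measurable.pred (\<Pi>\<^sub>M b\<in>B. unif) (\<lambda>x. x a \<le> x b)"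
    and lt: "Measurable.pred (\<Pi>\<^sub>M b\<in>B. unif) (\<lambda>x. x a < x b)"
    and "Measurable.pred (\<Pi>\<^sub>M b\<in>B. unif) (\<lambda>x. 0 \<le> x a)"
    and "Measurable.pred (\<Pi>\<^sub>M b\<in>B. unif) (\<lambda>x. x a < t)"
    if "a \<in> B" "b \<in> B" for a b
    using that unfolding pred_def
    by (simp_all only: borel_measurable_le borel_measurable_less comp borel_measurable_const)
  then have "Measurable.pred (\<Pi>\<^sub>M b\<in>B. unif) (\<lambda>x. (\<forall>b\<in>B. 0 \<le> x b \<and> x b < t) \<and>
     (\<forall>a\<in>B. \<forall>b\<in>B. a \<noteq> b \<longrightarrow> x a < x b \<or> x b < x a) \<and>
     (\<forall>a\<in>B. \<exists>S\<in>{S. S \<subseteq> B \<and> G S}. ?Q x a S))"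
    using assms fin(2)
    by (intro pred_intros_logic pred_intros_finite fin(1)) auto
  then show ?thesis by (simp only: growth_event_def neq_iff G pred_def)
qed

text \<open>The recursion for \<open>f\<close> says that \<open>card B! * f B\<close> counts the orders in which \<open>B\<close> can be
  built up through sets satisfying \<open>G\<close>.  The proof conditions on the box with the largest
  position.\<close>

lemma emeasure_growth_event:
  assumes "finite B" "0 \<le> t" "t \<le> 1" and f0: "f {} = 1"
    and nonneg: "\<And>S. S \<subseteq> B \<Longrightarrow> f S \<ge> 0"
    and good: "\<And>S. S \<subseteq> B \<Longrightarrow> S \<noteq> {} \<Longrightarrow> G S \<Longrightarrow> real (card S) * f S = (\<Sum>b\<in>S. f (S - {b}))"
    and bad: "\<And>S. S \<subseteq> B \<Longrightarrow> S \<noteq> {} \<Longrightarrow> \<not> G S \<Longrightarrow> f S = 0"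
  shows "emeasure (\<Pi>\<^sub>M b\<in>B. unif) (growth_event G B t) = ennreal (f B * t ^ card B)"
  using assms(1-3) nonneg good bad
proof (induction B arbitrary: t rule: finite_psubset_induct)
  case (psubset B)
  note nonneg = psubset.prems(3) and good = psubset.prems(4) and bad = psubset.prems(5)
  show ?case
  proof (cases "B = {}")
    case True
    then show ?thesis by (simp add: growth_event_def f0 PiM_empty)
  next
    case ne: False
    \<comment> \<open>At the largest position all of \<open>B\<close> is present, so the event
      forces \<open>G B\<close>.\<close>
    have top: "\<exists>m\<in>B. {b\<in>B. x b \<le> x m} = B" for x :: "'a \<Rightarrow> real"
    proof -
      have "Max (x ` B) \<in> x ` B" using psubset.hyps ne by (intro Max_in) auto
      then obtain m where "m \<in> B" "x m = Max (x ` B)" by auto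
      then show ?thesis using psubset.hyps by (intro bexI[of _ m]) auto
    qed
    show ?thesis
    proof (cases "G B")
      case False
      have "x \<notin> growth_event G B t" for x
      proof
        assume x: "x \<in> growth_event G B t"
        obtain m where "m \<in> B" "{b\<in>B. x b \<le> x m} = B" using top by blast
        moreover have "G {b\<in>B. x b \<le> x m}" using x \<open>m \<in> B\<close> by (simp add: growth_event_def)
        ultimately show False using False by simp
      qed
      then have "growth_event G B t = {}" by blast
      then show ?thesis using bad[of B] ne False by simp
    next
      case True
      obtain k where k: "card B = Suc k" using ne psubset.hyps by (metis card_0_eq not0_implies_Suc)
      \<comment> \<open>\<open>E m\<close> is the part of the event in which \<open>m\<close> comes
        last; distinctness of the positions makes these sets a partition.\<close>
      define E where "E m = growth_event G B t \<inter> {x \<in> space (\<Pi>\<^sub>M b\<in>B. unif). \<forall>b\<in>B-{m}. x b < x m}" for m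
      have comp: "(\<lambda>x. x b) \<in> borel_measurable (\<Pi>\<^sub>M b\<in>B. unif)" if "b \<in> B" for b
        using measurable_component_singleton[OF that, of "\<lambda>_. unif"] by (simp cong: measurable_cong_sets)
      have E_sets: "E m \<in> sets (\<Pi>\<^sub>M b\<in>B. unif)" if "m \<in> B" for m
        unfolding E_def using that psubset.hyps
        by (intro sets.Int sets_growth_event sets.sets_Collect_finite_All borel_measurable_less comp) auto
      have un: "growth_event G B t = (\<Union>m\<in>B. E m)"
      proof (intro equalityI subsetI)
        fix x assume x: "x \<in> growth_event G B t"
        obtain m where m: "m \<in> B" "{b\<in>B. x b \<le> x m} = B" using top by blast
        have "x b < x m" if "b \<in> B - {m}" for b
        proof -
          have "x b \<le> x m" using that m(2) by blast
          moreover have "x b \<noteq> x m" using x that m(1) by (auto simp: growth_event_def)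
          ultimately show ?thesis by simp
        qed
        then show "x \<in> (\<Union>m\<in>B. E m)" using x m(1) unfolding E_def growth_event_def by blast
      qed (auto simp: E_def)
      have disj: "disjoint_family_on E B"
        unfolding disjoint_family_on_def
      proof (intro ballI impI)
        fix m m' assume m: "m \<in> B" "m' \<in> B" "m \<noteq> m'"
        show "E m \<inter> E m' = {}"
        proof (rule ccontr)
          assume "E m \<inter> E m' \<noteq> {}"
          then obtain x where "x \<in> E m" "x \<in> E m'" by auto
          then have "x m' < x m" "x m < x m'" using m by (auto simp: E_def)
          then show False by simp
        qed
      qed
      have E: "emeasure (\<Pi>\<^sub>M b\<in>B. unif) (E m) = ennreal (f (B - {m}) * (t ^ Suc k / Suc k))" if m: "m \<in> B" for m
      proof -
        let ?I = "B - {m}"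
        have B: "B = insert m ?I" using m by auto
        interpret P: product_sigma_finite "\<lambda>_::'a. unif"
          by (intro product_sigma_finite.intro prob_space_imp_sigma_finite prob_space_unif)
        \<comment> \<open>Once the last position is fixed at \<open>s\<close>, the other elements
          must form a growth event below \<open>s\<close>; the test at \<open>m\<close> itself is
          \<open>G B\<close>, which holds in this case.\<close>
        have slice: "indicator (E m) (x(m := s)) = indicator {0..<t} s * (indicator (growth_event G ?I s) x :: ennreal)"
          if x: "x \<in> space (\<Pi>\<^sub>M b\<in>?I. unif)" for x s
        proof -
          have sp: "x(m := s) \<in> space (\<Pi>\<^sub>M b\<in>B. unif)"
            using x m by (auto simp: space_PiM PiE_def extensional_def)
          have c1: "{b\<in>B. (x(m := s)) b \<le> (x(m := s)) a} = {b\<in>?I. x b \<le> x a}"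
            if "\<forall>b\<in>?I. x b < s" "a \<in> ?I" for a
            using that by (auto simp: not_le dest: bspec)
          have c2: "{b\<in>B. (x(m := s)) b \<le> (x(m := s)) m} = B" if "\<forall>b\<in>?I. x b < s"
            using that by (auto intro: less_imp_le)
          have "x(m := s) \<in> E m \<longleftrightarrow> s \<in> {0..<t} \<and> x \<in> growth_event G ?I s"
          proof
            assume "x(m := s) \<in> E m"
            then have L: "(\<forall>b\<in>B. 0 \<le> (x(m := s)) b \<and> (x(m := s)) b < t) \<and>
                (\<forall>a\<in>B. \<forall>b\<in>B. a \<noteq> b \<longrightarrow> (x(m := s)) a \<noteq> (x(m := s)) b) \<and>
                (\<forall>a\<in>B. G {b\<in>B. (x(m := s)) b \<le> (x(m := s)) a}) \<and>
                (\<forall>b\<in>?I. (x(m := s)) b < (x(m := s)) m)"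
              unfolding E_def growth_event_def Int_iff mem_Collect_eq by (elim conjE) (intro conjI)
            note L = L[THEN conjunct1] L[THEN conjunct2, THEN conjunct1]
              L[THEN conjunct2, THEN conjunct2, THEN conjunct1] L[THEN conjunct2, THEN conjunct2, THEN conjunct2]
            from L(4) have lt: "\<forall>b\<in>?I. x b < s" by simp
            have "G {b\<in>?I. x b \<le> x a}" if a: "a \<in> ?I" for a
              using bspec[OF L(3), of a] a unfolding c1[OF lt a] by simp
            moreover have "0 \<le> x b" if "b \<in> ?I" for b
              using bspec[OF L(1), of b] that by simp
            moreover have "x a \<noteq> x b" if "a \<in> ?I" "b \<in> ?I" "a \<noteq> b" for a b
              using bspec[OF bspec[OF L(2), of a], of b] that by simp
            moreover have "0 \<le> s" "s < t" using bspec[OF L(1) m] by simp_all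
            ultimately show "s \<in> {0..<t} \<and> x \<in> growth_event G ?I s"
              using lt x unfolding growth_event_def by simp
          next
            assume R: "s \<in> {0..<t} \<and> x \<in> growth_event G ?I s"
            then have lt: "\<forall>b\<in>?I. x b < s" by (auto simp: growth_event_def)
            have "G {b\<in>B. (x(m := s)) b \<le> (x(m := s)) a}" if "a \<in> B" for a
            proof (cases "a = m")
              case True
              then show ?thesis using c2[OF lt] \<open>G B\<close> by simp
            next
              case False
              then have "a \<in> ?I" using that by simp
              then show ?thesis unfolding c1[OF lt \<open>a \<in> ?I\<close>] using R by (simp add: growth_event_def)
            qed
            moreover have "0 \<le> (x(m := s)) b \<and> (x(m := s)) b < t" if "b \<in> B" for b
              using R that lt by (cases "b = m") (auto simp: growth_event_def intro: less_trans)
            moreover have "(x(m := s)) a \<noteq> (x(m := s)) b" if "a \<in> B" "b \<in> B" "a \<noteq> b" for a b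
              using R that lt by (cases "a = m"; cases "b = m") (auto simp: growth_event_def)
            moreover have "\<forall>b\<in>?I. (x(m := s)) b < (x(m := s)) m" using lt by simp
            ultimately show "x(m := s) \<in> E m" 
              using sp unfolding E_def growth_event_def Int_iff mem_Collect_eq 
              by (intro conjI ballI impI) (simp_all del: fun_upd_apply)
          qed
          then show ?thesis by (auto split: split_indicator)
        qed
        \<comment> \<open>The bound is now the integration variable \<open>s\<close>, which is why
          \<open>t\<close> is arbitrary in the induction.\<close>
        have IH: "emeasure (\<Pi>\<^sub>M b\<in>?I. unif) (growth_event G ?I s) = ennreal (f ?I * s ^ k)" if "s \<in> {0..<t}" for s
        proof -
          have "?I \<subset> B" using m by auto
          from psubset.IH[OF this, of s] that psubset.prems(1,2) nonneg good bad k m psubset.hyps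
          show ?thesis by (simp add: subset_iff)
        qed
        have "emeasure (\<Pi>\<^sub>M b\<in>B. unif) (E m) = (\<integral>\<^sup>+x. indicator (E m) x \<partial>(\<Pi>\<^sub>M b\<in>insert m ?I. unif))"
          using E_sets[OF m] B by simp
        also have "\<dots> = (\<integral>\<^sup>+s. \<integral>\<^sup>+x. indicator (E m) (x(m := s)) \<partial>(\<Pi>\<^sub>M b\<in>?I. unif) \<partial>unif)"
          using E_sets[OF m] B psubset.hyps
          by (intro P.product_nn_integral_insert_rev borel_measurable_indicator) auto
        also have "\<dots> = (\<integral>\<^sup>+s. indicator {0..<t} s * emeasure (\<Pi>\<^sub>M b\<in>?I. unif) (growth_event G ?I s) \<partial>unif)"
          using psubset.hyps
          by (intro nn_integral_cong)
             (simp add: slice nn_integral_cmult_indicator sets_growth_event cong: nn_integral_cong)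
        also have "\<dots> = (\<integral>\<^sup>+s. ennreal (f ?I) * (ennreal (s ^ k) * indicator {0..<t} s) \<partial>unif)"
          using nonneg[of ?I] by (intro nn_integral_cong) (auto simp: IH ennreal_mult split: split_indicator)
        also have "\<dots> = ennreal (f ?I) * ennreal (t ^ Suc k / Suc k)"
          by (subst nn_integral_cmult) (auto simp: nn_integral_unif_power psubset.prems simp del: power_Suc)
        also have "\<dots> = ennreal (f ?I * (t ^ Suc k / Suc k))"
          using nonneg[of ?I] psubset.prems by (subst ennreal_mult) auto
        finally show ?thesis .
      qed
      have "emeasure (\<Pi>\<^sub>M b\<in>B. unif) (growth_event G B t) = (\<Sum>m\<in>B. emeasure (\<Pi>\<^sub>M b\<in>B. unif) (E m))"
        unfolding un using E_sets disj psubset.hyps by (intro sum_emeasure[symmetric]) auto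
      also have "\<dots> = (\<Sum>m\<in>B. ennreal (f (B - {m}) * (t ^ Suc k / Suc k)))"
        by (intro sum.cong refl E)
      also have "\<dots> = ennreal (\<Sum>m\<in>B. f (B - {m}) * (t ^ Suc k / Suc k))"
        using psubset.prems by (intro sum_ennreal mult_nonneg_nonneg nonneg) auto
      also have "(\<Sum>m\<in>B. f (B - {m}) * (t ^ Suc k / Suc k)) = (\<Sum>m\<in>B. f (B - {m})) * (t ^ Suc k / Suc k)"
        by (simp only: sum_distrib_right)
      \<comment> \<open>The factor \<open>Suc k\<close> cancels the denominator produced by
        integrating \<open>s ^ k\<close>.\<close>
      also have "(\<Sum>m\<in>B. f (B - {m})) = real (Suc k) * f B"
        using good[of B] ne True k by simp
      finally show ?thesis by (simp add: k del: of_nat_Suc power_Suc)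
    qed
  qed
qed

lemma AE_distinct_unif:
  assumes "finite B"
  shows "AE x in (\<Pi>\<^sub>M b\<in>B. unif). (\<forall>b\<in>B. x b \<in> {0..<1}) \<and> inj_on x B"
proof -
  interpret prob_space "\<Pi>\<^sub>M b\<in>B. unif" by (intro prob_space_PiM prob_space_unif)
  \<comment> \<open>If every set is allowed, the growth event just says that the positions are distinct.\<close>
  have "emeasure (\<Pi>\<^sub>M b\<in>B. unif) (growth_event (\<lambda>_. True) B 1) = ennreal (1 * 1 ^ card B)"
    using assms by (intro emeasure_growth_event[where f = "\<lambda>_. 1"]) auto
  then have "AE x in (\<Pi>\<^sub>M b\<in>B. unif). x \<in> growth_event (\<lambda>_. True) B 1"
    by (intro AE_prob_1) (simp add: measure_def)
  then show ?thesis
    by eventually_elim (auto simp: growth_event_def inj_on_def)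
qed

section \<open>Interlacing row counts\<close>

definition interlaced :: "nat \<Rightarrow> (nat \<Rightarrow> nat) \<Rightarrow> bool" where
  "interlaced n r \<longleftrightarrow> (\<forall>i<n. r i \<le> r (Suc i) \<and> r (Suc i) \<le> Suc (r i))"

text \<open>If \<open>r\<close> is interlaced, its columns read as a shifted diagram: \<open>r i\<close> is the number of parts
  that are at least \<open>Suc n - i\<close>.\<close>

definition strict_parts :: "nat \<Rightarrow> (nat \<Rightarrow> nat) \<Rightarrow> nat set" where
  "strict_parts n r = {l\<in>{1..n}. r (Suc n - l) = Suc (r (n - l))}"

text \<open>For the row counts of a set of boxes this is the fraction of orderings that stay
  interlaced throughout: the factorials order the boxes inside each row, and
  \<open>shifted_weight\<close> counts tableaux up to the factorial of the size.\<close>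

definition interlacing_weight :: "nat \<Rightarrow> (nat \<Rightarrow> nat) \<Rightarrow> real" where
  "interlacing_weight n r =
     (if interlaced n r then (\<Prod>i=1..n. fact (r i)) * shifted_weight (strict_parts n r) else 0)"

lemma interlacing_weight_nonneg: "interlacing_weight n r \<ge> 0"
  by (auto simp: interlacing_weight_def intro!: mult_nonneg_nonneg prod_nonneg shifted_weight_nonneg)

text \<open>Double counting: \<open>r i\<close> is the number of jumps of \<open>r\<close> at some
  \<open>k <= i\<close>, and a jump at \<open>k\<close> is seen by \<open>Suc n - k\<close> rows,
  which is exactly the part it encodes.\<close>

lemma sum_strict_parts:
  assumes "interlaced n r" "r 0 = 0"
  shows "\<Sum>(strict_parts n r) = (\<Sum>i=1..n. r i)"
proof -
  define P where "P k \<longleftrightarrow> r k = Suc (r (k - 1))" for k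
  have r: "r i = card {k\<in>{1..i}. P k}" if "i \<le> n" for i
    using that
  proof (induction i)
    case 0
    then show ?case using assms by simp
  next
    case (Suc i)
    have "r (Suc i) = (if P (Suc i) then Suc (r i) else r i)"
      using assms Suc.prems unfolding interlaced_def P_def by (auto simp: Suc_le_eq dest!: spec[of _ i])
    moreover have "{k\<in>{1..Suc i}. P k} = (if P (Suc i) then insert (Suc i) {k\<in>{1..i}. P k} else {k\<in>{1..i}. P k})"
      by (auto simp: le_Suc_eq)
    ultimately show ?case using Suc by simp
  qed
  have "(\<Sum>i=1..n. r i) = (\<Sum>i=1..n. \<Sum>k\<in>{k\<in>{1..n}. P k}. if k \<le> i then 1 else 0)"
  proof (rule sum.cong)
    fix i assume i: "i \<in> {1..n}"
    have "r i = card {k\<in>{1..i}. P k}" using r i by simp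
    also have "{k\<in>{1..i}. P k} = {k\<in>{k\<in>{1..n}. P k}. k \<le> i}" using i by auto
    also have "card \<dots> = (\<Sum>k\<in>{k\<in>{1..n}. P k}. if k \<le> i then 1 else 0)"
      by (subst sum.inter_filter[symmetric]) auto
    finally show "r i = (\<Sum>k\<in>{k\<in>{1..n}. P k}. if k \<le> i then 1 else 0)" .
  qed simp
  also have "\<dots> = (\<Sum>k\<in>{k\<in>{1..n}. P k}. \<Sum>i=1..n. if k \<le> i then 1 else 0)"
    by (rule sum.swap)
  also have "\<dots> = (\<Sum>k\<in>{k\<in>{1..n}. P k}. Suc n - k)"
  proof (rule sum.cong)
    fix k assume k: "k \<in> {k\<in>{1..n}. P k}"
    then have "{i\<in>{1..n}. k \<le> i} = {k..n}" by auto
    then show "(\<Sum>i=1..n. if k \<le> i then 1 else 0) = Suc n - k"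
      by (subst sum.inter_filter[symmetric]) auto
  qed simp
  also have "\<dots> = \<Sum>(strict_parts n r)"
    by (rule sum.reindex_bij_witness[of _ "\<lambda>l. Suc n - l" "\<lambda>k. Suc n - k"])
       (auto simp: strict_parts_def P_def Suc_diff_le)
  finally show ?thesis by simp
qed

text \<open>Taking a box out of row \<open>i\<close> lowers the part \<open>l\<close> by one.
  Interlacing with the row above survives iff \<open>l\<close> is a part, with the row below iff
  \<open>l - 1\<close> is not. The factor \<open>r i\<close> restores
  \<open>fact (r i)\<close>.\<close>

lemma interlacing_weight_decrease:
  assumes r: "interlaced n r" and i: "i \<in> {1..n}"
  defines "L \<equiv> strict_parts n r" and "l \<equiv> Suc n - i"
  shows "real (r i) * interlacing_weight n (r(i := r i - 1)) = (\<Prod>k=1..n. fact (r k)) *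
    (if l \<in> L \<and> l - 1 \<notin> L then shifted_weight (insert (l - 1) (L - {l})) else 0)"
proof -
  let ?r = "r(i := r i - 1)"
  have l: "l \<in> {1..n}" "Suc n - l = i" "n - l = i - 1" using i by (auto simp: l_def)
  have lL: "l \<in> L \<longleftrightarrow> r i = Suc (r (i - 1))" using l by (simp add: L_def strict_parts_def)
  \<comment> \<open>For \<open>i = n\<close> there is no row below; accordingly \<open>l - 1\<close>
    is 0, which is never a part.\<close>
  have l1L: "l - 1 \<in> L \<longleftrightarrow> i < n \<and> r (Suc i) = Suc (r i)"
  proof (cases "i < n")
    case True
    then have "l - 1 \<in> {1..n}" "Suc n - (l - 1) = Suc i" "n - (l - 1) = i" using i by (auto simp: l_def)
    then show ?thesis using True by (simp add: L_def strict_parts_def)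
  next
    case False
    then have "l - 1 = 0" using i by (auto simp: l_def)
    then show ?thesis using False by (simp add: L_def strict_parts_def)
  qed
  show ?thesis
  \<comment> \<open>Here \<open>r i - 1\<close> is truncated, but both sides are 0 because
    \<open>l\<close> is not a part.\<close>
  proof (cases "r i = 0")
    case True
    then show ?thesis using lL by simp
  next
    case False
    have ri: "r (i - 1) \<le> r i" "r i \<le> Suc (r (i - 1))"
      using r i unfolding interlaced_def by (auto dest: spec[of _ "i - 1"])
    have adm: "interlaced n ?r \<longleftrightarrow> l \<in> L \<and> l - 1 \<notin> L"
    proof
      assume A: "interlaced n ?r"
      have "?r (i - 1) \<le> ?r i" using A i unfolding interlaced_def by (auto dest: spec[of _ "i - 1"])
      then have "r i = Suc (r (i - 1))" using ri False i by (cases "i - 1 = i") auto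
      moreover have "\<not> (i < n \<and> r (Suc i) = Suc (r i))"
      proof
        assume *: "i < n \<and> r (Suc i) = Suc (r i)"
        then have "?r (Suc i) \<le> Suc (?r i)" using A unfolding interlaced_def by blast
        then show False using * False by simp
      qed
      ultimately show "l \<in> L \<and> l - 1 \<notin> L" using lL l1L by simp
    next
      assume A: "l \<in> L \<and> l - 1 \<notin> L"
      have "?r k \<le> ?r (Suc k) \<and> ?r (Suc k) \<le> Suc (?r k)" if k: "k < n" for k
      proof -
        have "r k \<le> r (Suc k) \<and> r (Suc k) \<le> Suc (r k)" using r k by (simp add: interlaced_def)
        then show ?thesis using A lL l1L k False by (cases "k = i"; cases "Suc k = i") auto
      qed
      then show "interlaced n ?r" by (simp add: interlaced_def)
    qed
    show ?thesis
    proof (cases "interlaced n ?r")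
      case False
      then show ?thesis using adm by (auto simp: interlacing_weight_def)
    next
      case True
      then have A: "l \<in> L" "l - 1 \<notin> L" using adm by auto
      \<comment> \<open>Zero is taken out because a part 1 lowered to 0 disappears from the
        partition.\<close>
      have "k \<in> strict_parts n ?r \<longleftrightarrow> k \<in> insert (l - 1) (L - {l}) - {0}" for k
      proof (cases "k \<in> {1..n}")
        case False
        then show ?thesis using l by (auto simp: strict_parts_def L_def)
      next
        case k: True
        consider "k = l" | "k = l - 1" | "k \<noteq> l" "k \<noteq> l - 1" by blast
        then show ?thesis
        proof cases
          case 1
          have "r i = Suc (r (i - 1))" "i - 1 \<noteq> i" using A(1) lL i by auto
          then have "?r (Suc n - l) \<noteq> Suc (?r (n - l))" unfolding l(2,3) by simp
          then have "l \<notin> strict_parts n ?r" unfolding strict_parts_def by blast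
          moreover have "l \<noteq> l - 1" using l(1) by auto
          ultimately show ?thesis unfolding \<open>k = l\<close> by simp
        next
          case 2
          then have "Suc n - k = Suc i" "n - k = i" "i < n" using k i by (auto simp: l_def)
          moreover from this have "r (Suc i) = r i" using r A(2) l1L unfolding interlaced_def
            by (auto dest!: spec[of _ i])
          ultimately show ?thesis using k 2 \<open>r i \<noteq> 0\<close> by (simp add: strict_parts_def)
        next
          case 3
          then have "Suc n - k \<noteq> i" "n - k \<noteq> i" using k i by (auto simp: l_def)
          then show ?thesis using 3 k by (simp add: strict_parts_def L_def)
        qed
      qed
      then have parts: "strict_parts n ?r = insert (l - 1) (L - {l}) - {0}" by blast
      have fl: "finite L" by (simp add: L_def strict_parts_def)
      have sw: "shifted_weight (strict_parts n ?r) = shifted_weight (insert (l - 1) (L - {l}))"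
        unfolding parts using fl by (intro shifted_weight_remove_0) simp
      have "(\<Prod>k=1..n. fact (?r k) :: real) = fact (r i - 1) * (\<Prod>k\<in>{1..n}-{i}. fact (?r k))"
        using i by (subst prod.remove[of _ i]) auto
      also have "(\<Prod>k\<in>{1..n}-{i}. fact (?r k)) = (\<Prod>k\<in>{1..n}-{i}. fact (r k) :: real)"
        by (intro prod.cong) auto
      finally have "real (r i) * (\<Prod>k=1..n. fact (?r k)) = fact (r i) * (\<Prod>k\<in>{1..n}-{i}. fact (r k))"
        using False by (simp add: fact_reduce[of "r i"])
      also have "\<dots> = (\<Prod>k=1..n. fact (r k))"
        using i by (subst prod.remove[of _ i]) auto
      finally show ?thesis
        using True A unfolding interlacing_weight_def sw by (simp flip: mult.assoc)
    qed
  qed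
qed

text \<open>The tableau recursion is transported to rows by the reflection
  \<open>l = Suc n - i\<close>.\<close>

lemma interlacing_weight_recursion:
  assumes "interlaced n r" "r 0 = 0"
  shows "real (\<Sum>i=1..n. r i) * interlacing_weight n r =
    (\<Sum>i=1..n. real (r i) * interlacing_weight n (r(i := r i - 1)))"
proof -
  define L where "L = strict_parts n r"
  have L: "finite L" "0 \<notin> L" "L \<subseteq> {1..n}" by (auto simp: L_def strict_parts_def)
  let ?F = "\<Prod>k=1..n. fact (r k) :: real"
  let ?h = "\<lambda>l. if l \<in> L \<and> l - 1 \<notin> L then shifted_weight (insert (l - 1) (L - {l})) else 0"
  have "(\<Sum>i=1..n. real (r i) * interlacing_weight n (r(i := r i - 1))) = (\<Sum>i=1..n. ?F * ?h (Suc n - i))"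
    by (intro sum.cong refl) (simp only: interlacing_weight_decrease[OF assms(1)] L_def)
  also have "\<dots> = (\<Sum>l=1..n. ?F * ?h l)"
    by (rule sum.reindex_bij_witness[of _ "\<lambda>l. Suc n - l" "\<lambda>k. Suc n - k"]) auto
  also have "\<dots> = ?F * (\<Sum>l=1..n. ?h l)" by (simp only: sum_distrib_left)
  also have "(\<Sum>l=1..n. ?h l) = (\<Sum>l\<in>{l\<in>{1..n}. l \<in> L \<and> l - 1 \<notin> L}. shifted_weight (insert (l - 1) (L - {l})))"
    by (rule sum.inter_filter[symmetric]) simp
  also have "{l\<in>{1..n}. l \<in> L \<and> l - 1 \<notin> L} = {l\<in>L. l - 1 \<notin> L}" using L by blast
  also have "(\<Sum>l\<in>{l\<in>L. l - 1 \<notin> L}. shifted_weight (insert (l - 1) (L - {l}))) = real (\<Sum>L) * shifted_weight L"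
    by (rule sum_shifted_weight_decrease[OF L(1,2)])
  also have "?F * (real (\<Sum>L) * shifted_weight L) = real (\<Sum>i=1..n. r i) * interlacing_weight n r"
    using assms(1) unfolding L_def sum_strict_parts[OF assms] interlacing_weight_def by simp
  finally show ?thesis by (rule sym)
qed

section \<open>Row counts of sets of boxes\<close>

definition row_count :: "(nat \<times> nat) set \<Rightarrow> nat \<Rightarrow> nat" where
  "row_count S i = card {j. (i, j) \<in> S}"

lemma boxes_eq_Sigma: "boxes n = Sigma {1..n} (\<lambda>i. {1..i})"
  by (auto simp: boxes_def)

lemma finite_boxes: "finite (boxes n)"
  by (simp add: boxes_eq_Sigma)

text \<open>All boxes of \<open>S\<close> in one row give the same summand, so the sum over boxes
  becomes the sum over rows weighted by the row counts. This supplies the recursion that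
  \<open>emeasure_growth_event\<close> asks for.\<close>

lemma interlacing_weight_boxes_recursion:
  assumes S: "S \<subseteq> boxes n" and int: "interlaced n (row_count S)"
  shows "real (card S) * interlacing_weight n (row_count S) =
    (\<Sum>b\<in>S. interlacing_weight n (row_count (S - {b})))"
proof -
  let ?R = "\<lambda>i. {j. (i, j) \<in> S}"
  have fin: "finite (?R i)" for i
    by (rule finite_subset[of _ "{1..i}"]) (use S in \<open>auto simp: boxes_def\<close>)
  have Sig: "S = Sigma {1..n} ?R" using S by (auto simp: boxes_def)
  have r0: "row_count S 0 = 0" using S fin by (auto simp: row_count_def boxes_def)
  have rm: "row_count (S - {(i, j)}) = (row_count S)(i := row_count S i - 1)" if "(i, j) \<in> S" for i j
  proof
    fix k
    show "row_count (S - {(i, j)}) k = ((row_count S)(i := row_count S i - 1)) k"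
    proof (cases "k = i")
      case True
      have "{j'. (i, j') \<in> S - {(i, j)}} = ?R i - {j}" by auto
      then show ?thesis using True that fin by (simp add: row_count_def)
    next
      case False
      then have "{j'. (k, j') \<in> S - {(i, j)}} = ?R k" by auto
      then show ?thesis using False by (simp add: row_count_def)
    qed
  qed
  have "(\<Sum>b\<in>S. interlacing_weight n (row_count (S - {b}))) =
      (\<Sum>b\<in>Sigma {1..n} ?R. interlacing_weight n ((row_count S)(fst b := row_count S (fst b) - 1)))"
    using Sig rm by (intro sum.cong) (auto simp del: fun_upd_apply)
  also have "\<dots> = (\<Sum>(i, j)\<in>Sigma {1..n} ?R. interlacing_weight n ((row_count S)(i := row_count S i - 1)))"
    by (simp add: case_prod_unfold)
  also have "\<dots> = (\<Sum>i=1..n. \<Sum>j\<in>?R i. interlacing_weight n ((row_count S)(i := row_count S i - 1)))"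
    using fin by (subst sum.Sigma) auto
  also have "\<dots> = (\<Sum>i=1..n. real (row_count S i) * interlacing_weight n ((row_count S)(i := row_count S i - 1)))"
    by (simp add: row_count_def)
  also have "\<dots> = real (\<Sum>i=1..n. row_count S i) * interlacing_weight n (row_count S)"
    using interlacing_weight_recursion[OF int r0] by simp
  also have "(\<Sum>i=1..n. row_count S i) = card S"
    by (subst Sig, subst card_SigmaI) (auto simp: fin row_count_def)
  finally show ?thesis by simp
qed

lemma row_count_boxes: "i \<le> n \<Longrightarrow> row_count (boxes n) i = i"
proof -
  assume "i \<le> n"
  then have "{j. (i, j) \<in> boxes n} = {1..i}" by (auto simp: boxes_def)
  then show ?thesis by (simp add: row_count_def)
qed

section \<open>The labelling procedure\<close>

lemma first_right_in:
  assumes "finite U" "U \<noteq> {}"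
  shows "first_right y c U \<in> U"
    and "\<And>j. j \<in> U \<Longrightarrow> frac (y (first_right y c U) - c) \<le> frac (y j - c)"
  using arg_min_if_finite[OF assms, of "\<lambda>j. frac (y j - c)"] by (auto simp: first_right_def not_less)

text \<open>The cardinality condition leaves exactly one box when the list is exhausted, so
  \<open>the_elem\<close> is applied to a singleton.\<close>

lemma label_row_permutation:
  assumes "finite U" "card U = Suc (length cs)"
  shows "distinct (label_row y cs U) \<and> set (label_row y cs U) = U"
  using assms
proof (induction cs arbitrary: U)
  case Nil
  then obtain u where "U = {u}" by (auto simp: card_1_singleton_iff)
  then show ?case by simp
next
  case (Cons c cs)
  let ?j = "first_right y c U"
  have j: "?j \<in> U" using Cons.prems by (intro first_right_in) auto
  then have "card (U - {?j}) = Suc (length cs)" using Cons.prems by simp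
  then show ?case using Cons.IH[of "U - {?j}"] Cons.prems j by auto
qed

lemma boxes_by_label_permutation:
  "distinct (boxes_by_label x i) \<and> set (boxes_by_label x i) = {1..i}"
proof (induction i)
  case (Suc i)
  then have "length (boxes_by_label x i) = i" by (metis card_atLeastAtMost diff_Suc_1 distinct_card)
  then show ?case unfolding boxes_by_label.simps by (intro label_row_permutation) auto
qed simp

text \<open>If \<open>c\<close> lies beyond \<open>y m\<close>, every box is reached by wrapping
  around and a lower one comes first; if some other box lies at or beyond \<open>c\<close>, it is
  met before \<open>m\<close>. Both need a competitor, since a lone box is always chosen.\<close>

lemma first_right_eq_top_iff:
  assumes y: "\<And>j. j \<in> U \<Longrightarrow> y j \<in> {0..<1}" and c: "c \<in> {0..<1}"
    and U: "finite U" "m \<in> U" "\<And>j. j \<in> U - {m} \<Longrightarrow> y j < y m" "U - {m} \<noteq> {}"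
  shows "first_right y c U = m \<longleftrightarrow> c \<le> y m \<and> (\<forall>j\<in>U-{m}. y j < c)"
proof
  assume m: "first_right y c U = m"
  have le: "frac (y m - c) \<le> frac (y j - c)" if "j \<in> U" for j
    using first_right_in(2)[of U j y c] that U m by auto
  have "c \<le> y m"
  proof (rule ccontr)
    assume "\<not> c \<le> y m"
    obtain j where j: "j \<in> U - {m}" using U(4) by blast
    with U(3) have "y j < y m" by blast
    then show False
      using le[of j] j \<open>\<not> c \<le> y m\<close> y[of j] y[OF U(2)] c
      by (simp add: frac_diff_unit_interval split: if_splits)
  qed
  moreover have "y j < c" if j: "j \<in> U - {m}" for j
  proof (rule ccontr)
    assume "\<not> y j < c"
    then show False
      using le[of j] j \<open>c \<le> y m\<close> U(3)[OF j] y[of j] y[OF U(2)] c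
      by (simp add: frac_diff_unit_interval split: if_splits)
  qed
  ultimately show "c \<le> y m \<and> (\<forall>j\<in>U-{m}. y j < c)" by blast
next
  assume A: "c \<le> y m \<and> (\<forall>j\<in>U-{m}. y j < c)"
  let ?j = "first_right y c U"
  have j: "?j \<in> U" "frac (y ?j - c) \<le> frac (y m - c)"
    using first_right_in(1)[OF U(1), of y c] first_right_in(2)[OF U(1) _ U(2), of y c] U(2) by blast+
  show "?j = m"
  proof (rule ccontr)
    assume "?j \<noteq> m"
    then have "?j \<in> U - {m}" using j by blast
    then have "y ?j < c" using A by blast
    then show False using j(2) A y[OF j(1)] y[OF U(2)] c
      by (simp add: frac_diff_unit_interval split: if_splits)
  qed
qed

text \<open>A decreasing new row means that each box takes the topmost free one, so exactly one free
  position exceeds \<open>c\<close>. Removing \<open>c\<close> and that top box preserves the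
  counting inequalities, which drives the induction.\<close>

lemma label_row_decreasing_iff:
  assumes "finite U" "card U = Suc (length cs)"
    and "\<And>j. j \<in> U \<Longrightarrow> y j \<in> {0..<1}" and "set cs \<subseteq> {0..<1}" and "set cs \<inter> y ` U = {}"
  shows "sorted_wrt (>) (map y (label_row y cs U)) \<longleftrightarrow> sorted_wrt (>) cs \<and>
    (\<forall>s. length (filter (\<lambda>c. c \<le> s) cs) \<le> card {j\<in>U. y j \<le> s} \<and>
         card {j\<in>U. y j \<le> s} \<le> Suc (length (filter (\<lambda>c. c \<le> s) cs)))"
    (is "_ \<longleftrightarrow> _ \<and> (\<forall>s. ?A s cs U)")
  using assms
proof (induction cs arbitrary: U)
  case Nil
  have "card {j\<in>U. y j \<le> s} \<le> card U" for s by (rule card_mono) (use Nil in auto)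
  then show ?case using Nil by simp
next
  case (Cons c cs)
  let ?j = "first_right y c U"
  let ?top = "\<lambda>m. m \<in> U \<and> c < y m \<and> (\<forall>j\<in>U-{m}. y j < c)"
  have finU: "finite U" by (rule Cons.prems)
  have cne: "c \<noteq> y j" if "j \<in> U" for j using Cons.prems(5) that by auto
  have len: "length (filter (\<lambda>c. c \<le> s) cs) \<le> length cs" for s by simp
  have rest: "sorted_wrt (>) (map y (label_row y cs (U - {m}))) \<longleftrightarrow> sorted_wrt (>) cs \<and> (\<forall>s. ?A s cs (U - {m}))"
    and rest_perm: "set (label_row y cs (U - {m})) = U - {m}" if "m \<in> U" for m
  proof -
    have "card (U - {m}) = Suc (length cs)" using that Cons.prems by simp
    then show "sorted_wrt (>) (map y (label_row y cs (U - {m}))) \<longleftrightarrow> sorted_wrt (>) cs \<and> (\<forall>s. ?A s cs (U - {m}))"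
      using Cons.prems by (intro Cons.IH) auto
    show "set (label_row y cs (U - {m})) = U - {m}"
      using \<open>card (U - {m}) = Suc (length cs)\<close> finU label_row_permutation by blast
  qed
  have card_rest: "card (U - {m}) = Suc (length cs)" if "m \<in> U" for m
    using that Cons.prems by simp
  have rest_ne: "U - {m} \<noteq> {}" if "m \<in> U" for m
    using card_rest[OF that] by (metis card.empty nat.distinct(1))
  \<comment> \<open>Below \<open>c\<close> neither \<open>c\<close> nor \<open>m\<close> is counted.
    From \<open>c\<close> on, all of \<open>cs\<close> and all of \<open>U - {m}\<close> are counted
    and both sets of inequalities hold automatically.\<close>
  have counts: "(\<forall>s. ?A s (c # cs) U) \<longleftrightarrow> (\<forall>s. ?A s cs (U - {m}))"
    if m: "?top m" and lt: "\<forall>c'\<in>set cs. c' < c" for m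
  proof -
    have "?A s (c # cs) U \<longleftrightarrow> ?A s cs (U - {m})" for s
    proof (cases "s < c")
      case True
      then have "{j\<in>U. y j \<le> s} = {j\<in>U-{m}. y j \<le> s}" using m by auto
      then show ?thesis using True by simp
    next
      case False
      have sub: "U - {m} \<subseteq> {j\<in>U. y j \<le> s}" using m False by force
      then have "card (U - {m}) \<le> card {j\<in>U. y j \<le> s}" using finU by (intro card_mono) auto
      moreover have "card {j\<in>U. y j \<le> s} \<le> card U" using finU by (intro card_mono) auto
      moreover have "{j\<in>U-{m}. y j \<le> s} = U - {m}" using sub by blast
      moreover have "filter (\<lambda>c. c \<le> s) cs = cs" using lt False by (intro filter_True) auto
      ultimately show ?thesis using False Cons.prems(2) card_rest m by simp
    qed
    then show ?thesis by simp
  qed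
  show ?case
  proof
    assume L: "sorted_wrt (>) (map y (label_row y (c # cs) U))"
    have j: "?j \<in> U" using finU Cons.prems(2) by (intro first_right_in) auto
    have big: "y d < y ?j" if "d \<in> U - {?j}" for d using L rest_perm[OF j] that by auto
    have "c \<in> {0..<1}" using Cons.prems(4) by simp
    from first_right_eq_top_iff[of U y, OF Cons.prems(3) this finU j big rest_ne[OF j]]
    have "c \<le> y ?j \<and> (\<forall>d\<in>U-{?j}. y d < c)" by blast
    then have top: "?top ?j" using cne[OF j] j by auto
    have R: "sorted_wrt (>) cs" "\<forall>s. ?A s cs (U - {?j})" using L rest[OF j] by auto
    \<comment> \<open>At this level all of \<open>U - {?j}\<close> is counted, which forces all of
      \<open>cs\<close> to lie at or below \<open>s\<close>, hence below \<open>c\<close>.\<close>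
    define s where "s = Max (y ` (U - {?j}))"
    have "s \<in> y ` (U - {?j})" unfolding s_def using finU rest_ne[OF j] by (intro Max_in) auto
    then have "s < c" using top by auto
    have "{d\<in>U-{?j}. y d \<le> s} = U - {?j}" using finU by (auto simp: s_def)
    then have "length cs \<le> length (filter (\<lambda>c. c \<le> s) cs)"
      using spec[OF R(2), of s] card_rest[OF j] by simp
    then have "filter (\<lambda>c. c \<le> s) cs = cs" by (metis le_antisym length_filter_le length_filter_less nat_less_le filter_True)
    then have "\<forall>c'\<in>set cs. c' < c" using \<open>s < c\<close> by (auto simp: filter_id_conv)
    with counts[OF top] R show "sorted_wrt (>) (c # cs) \<and> (\<forall>s. ?A s (c # cs) U)" by auto
  next
    assume R: "sorted_wrt (>) (c # cs) \<and> (\<forall>s. ?A s (c # cs) U)"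
    then have lt: "\<forall>c'\<in>set cs. c' < c" and A: "\<And>s. ?A s (c # cs) U" by auto
    \<comment> \<open>Otherwise a level below \<open>c\<close> would count all
      \<open>length cs + 2\<close> boxes of \<open>U\<close> but at most \<open>length cs\<close> of
      the row above.\<close>
    have "\<exists>m\<in>U. c < y m"
    proof (rule ccontr)
      assume "\<not> (\<exists>m\<in>U. c < y m)"
      then have lt: "y j < c" if "j \<in> U" for j using cne[OF that] that by force
      define s where "s = Max (y ` U)"
      have "s \<in> y ` U" unfolding s_def using finU Cons.prems(2) by (intro Max_in) auto
      then have "s < c" using lt by auto
      moreover have "{d\<in>U. y d \<le> s} = U" using finU by (auto simp: s_def)
      ultimately show False using A[of s] Cons.prems(2) len[of s] by simp
    qed
    then obtain m where m: "m \<in> U" "c < y m" by blast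
    \<comment> \<open>At level \<open>c\<close> the whole row above is counted, so at most one box
      of \<open>U\<close> can lie beyond \<open>c\<close>.\<close>
    have eq: "{j\<in>U. y j \<le> c} = U - {m}"
    proof (rule card_seteq)
      have "filter (\<lambda>c'. c' \<le> c) cs = cs" using lt by (intro filter_True) auto
      then show "card (U - {m}) \<le> card {j\<in>U. y j \<le> c}" using A[of c] card_rest[OF m(1)] by simp
    qed (use finU m in auto)
    have "y j < c" if "j \<in> U - {m}" for j
    proof -
      have "j \<in> {j\<in>U. y j \<le> c}" unfolding eq by (rule that)
      then show ?thesis using cne[of j] by auto
    qed
    then have top: "?top m" using m by blast
    have big: "y j < y m" if "j \<in> U - {m}" for j using top that by force
    have "c \<in> {0..<1}" using Cons.prems(4) by simp
    from first_right_eq_top_iff[of U y, OF Cons.prems(3) this finU m(1) big rest_ne[OF m(1)]]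
    have "?j = m" using top by force
    moreover have "sorted_wrt (>) (map y (label_row y cs (U - {m})))"
      using rest[OF m(1)] counts[OF top lt] R by auto
    ultimately show "sorted_wrt (>) (map y (label_row y (c # cs) U))"
      using rest_perm[OF m(1)] big by simp
  qed
qed

lemma filter_map_boxes_by_label:
  "length (filter (\<lambda>c. c \<le> s) (map (\<lambda>j. x (i, j)) (boxes_by_label x i))) = card {j\<in>{1..i}. x (i, j) \<le> s}"
proof -
  let ?l = "boxes_by_label x i"
  have "length (filter (\<lambda>c. c \<le> s) (map (\<lambda>j. x (i, j)) ?l)) = length (filter (\<lambda>j. x (i, j) \<le> s) ?l)"
    by (simp add: filter_map o_def)
  also have "\<dots> = card (set (filter (\<lambda>j. x (i, j) \<le> s) ?l))"
    using boxes_by_label_permutation[of x i] by (intro distinct_card[symmetric]) simp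
  also have "set (filter (\<lambda>j. x (i, j) \<le> s) ?l) = {j\<in>{1..i}. x (i, j) \<le> s}"
    using boxes_by_label_permutation[of x i] by auto
  finally show ?thesis .
qed

text \<open>The criterion for one step already contains that the row above is decreasing, so it
  unfolds down to the empty row 0 into conditions on all consecutive rows.\<close>

lemma boxes_by_label_decreasing_iff:
  assumes "inj_on x (boxes n)" "\<And>b. b \<in> boxes n \<Longrightarrow> x b \<in> {0..<1}" "m \<le> n"
  shows "sorted_wrt (>) (map (\<lambda>j. x (m, j)) (boxes_by_label x m)) \<longleftrightarrow>
    (\<forall>i<m. \<forall>s. card {j\<in>{1..i}. x (i, j) \<le> s} \<le> card {j\<in>{1..Suc i}. x (Suc i, j) \<le> s} \<and>
       card {j\<in>{1..Suc i}. x (Suc i, j) \<le> s} \<le> Suc (card {j\<in>{1..i}. x (i, j) \<le> s}))"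
  using assms(3)
proof (induction m)
  case (Suc m)
  let ?cs = "map (\<lambda>j. x (m, j)) (boxes_by_label x m)"
  have perm: "distinct (boxes_by_label x m)" "set (boxes_by_label x m) = {1..m}"
    using boxes_by_label_permutation by blast+
  have len: "length (boxes_by_label x m) = m"
    using distinct_card[OF perm(1)] perm(2) by simp
  have row: "(Suc m, j) \<in> boxes n" if "j \<in> {1..Suc m}" for j using that Suc.prems by (auto simp: boxes_def)
  have row': "(m, j) \<in> boxes n" if "j \<in> {1..m}" for j using that Suc.prems by (auto simp: boxes_def)
  have "sorted_wrt (>) (map (\<lambda>j. x (Suc m, j)) (label_row (\<lambda>j. x (Suc m, j)) ?cs {1..Suc m})) \<longleftrightarrow>
    sorted_wrt (>) ?cs \<and>
    (\<forall>s. length (filter (\<lambda>c. c \<le> s) ?cs) \<le> card {j\<in>{1..Suc m}. x (Suc m, j) \<le> s} \<and>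
         card {j\<in>{1..Suc m}. x (Suc m, j) \<le> s} \<le> Suc (length (filter (\<lambda>c. c \<le> s) ?cs)))"
  proof (rule label_row_decreasing_iff)
    show "set ?cs \<subseteq> {0..<1}" using perm(2) row' assms(2) by auto
    show "set ?cs \<inter> (\<lambda>j. x (Suc m, j)) ` {1..Suc m} = {}"
    proof -
      have "x (m, a) \<noteq> x (Suc m, b)" if "a \<in> {1..m}" "b \<in> {1..Suc m}" for a b
        using inj_onD[OF assms(1) _ row'[OF that(1)] row[OF that(2)]] by auto
      then show ?thesis using perm(2) by auto
    qed
  qed (use row assms(2) len in auto)
  then show ?case
    unfolding boxes_by_label.simps filter_map_boxes_by_label
    using Suc.IH Suc.prems by (simp add: less_Suc_eq all_conj_distrib imp_conjL)
qed simp

text \<open>Sorting is stable, so tied keys would keep their increasing order; a full reversal thus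
  excludes ties. As no distinctness is assumed, the equivalence also serves for measurability on the
  whole space.\<close>

lemma sort_key_eq_rev_iff:
  fixes f :: "nat \<Rightarrow> 'a::linorder"
  shows "sort_key f [1..<Suc n] = rev [1..<Suc n] \<longleftrightarrow> sorted_wrt (>) (map f [1..<Suc n])"
proof
  assume L: "sort_key f [1..<Suc n] = rev [1..<Suc n]"
  have "sorted (rev (map f [1..<Suc n]))"
    using sorted_sort_key[of f "[1..<Suc n]"] unfolding L by (simp add: rev_map)
  then have weak: "sorted_wrt (\<ge>) (map f [1..<Suc n])"
    unfolding sorted_wrt_rev by simp
  have ne: "f a \<noteq> f b" if ab: "a < b" "a \<in> {1..n}" "b \<in> {1..n}" for a b
  proof
    assume eq: "f a = f b"
    \<comment> \<open>Stability makes this tie class equal to its own reverse although it is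
      strictly increasing, so it has at most one element.\<close>
    let ?z = "filter (\<lambda>y. f y = f b) [1..<Suc n]"
    have z: "rev ?z = ?z" using sort_key_stable[of f "f b" "[1..<Suc n]"] unfolding L by (simp add: rev_filter)
    have "sorted_wrt (<) ?z" by (intro sorted_wrt_filter sorted_wrt_upt)
    moreover from this have "sorted_wrt (>) ?z" by (subst z[symmetric]) (simp only: sorted_wrt_rev)
    ultimately have "sorted_wrt (\<lambda>_ _. False) ?z"
      unfolding sorted_wrt_iff_nth_less by (metis less_asym)
    then have "length ?z \<le> 1" by (cases ?z; cases "tl ?z") auto
    moreover have "card {a, b} \<le> card (set ?z)" using ab eq by (intro card_mono) (auto simp del: upt_Suc)
    moreover have "card {a, b} = 2" using ab by simp
    ultimately show False using card_length[of ?z] by linarith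
  qed
  show "sorted_wrt (>) (map f [1..<Suc n])"
    unfolding sorted_wrt_iff_nth_less
  proof (intro allI impI)
    fix i j assume ij: "i < j" "j < length (map f [1..<Suc n])"
    have "map f [1..<Suc n] ! j \<le> map f [1..<Suc n] ! i"
      using sorted_wrt_nth_less[OF weak ij] .
    moreover have "f (Suc i) \<noteq> f (Suc j)" using ij by (intro ne) (auto simp del: upt_Suc)
    ultimately show "map f [1..<Suc n] ! i > map f [1..<Suc n] ! j"
      using ij by (simp del: upt_Suc)
  qed
next
  assume R: "sorted_wrt (>) (map f [1..<Suc n])"
  have inj: "inj_on f (set [1..<Suc n])"
  proof -
    have "distinct (map f [1..<Suc n])"
      unfolding distinct_conv_nth using sorted_wrt_nth_less[OF R] by (metis less_irrefl linorder_neqE_nat)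
    then show ?thesis unfolding distinct_map by (rule conjunct2)
  qed
  show "sort_key f [1..<Suc n] = rev [1..<Suc n]"
  proof (rule properties_for_sort_key)
    fix k assume "k \<in> set (rev [1..<Suc n])"
    then have k: "k \<in> set [1..<Suc n]" by simp
    obtain xs ys where split: "[1..<Suc n] = xs @ k # ys" using split_list[OF k] by blast
    have "distinct (xs @ k # ys)" unfolding split[symmetric] by (rule distinct_upt)
    then have "f k \<noteq> f y" if "y \<in> set xs \<union> set ys" for y
      using inj that unfolding split by (auto simp: inj_on_def)
    then have "filter (\<lambda>y. f k = f y) [1..<Suc n] = [k]"
      unfolding split by (simp add: filter_empty_conv)
    then show "filter (\<lambda>y. f k = f y) (rev [1..<Suc n]) = filter (\<lambda>y. f k = f y) [1..<Suc n]"
      by (simp only: rev_filter[symmetric] rev_singleton_conv)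
  next
    show "sorted (map f (rev [1..<Suc n]))" 
      using R unfolding rev_map[symmetric] sorted_wrt_rev by (rule sorted_wrt_mono_rel[rotated]) auto
  qed simp
qed

lemma row_word_eq_rev_iff:
  "row_word x n = rev [1..<Suc n] \<longleftrightarrow> sorted_wrt (>) (map (\<lambda>j. x (n, j)) (boxes_by_label x n))"
proof -
  have len: "length (boxes_by_label x n) = n"
    using boxes_by_label_permutation[of x n] distinct_card by fastforce
  have "map (label_position x n) [1..<Suc n] = map (\<lambda>j. x (n, j)) (boxes_by_label x n)"
    by (rule nth_equalityI) (auto simp: len label_position_def simp del: upt_Suc)
  then show ?thesis unfolding row_word_def sort_key_eq_rev_iff by simp
qed

section \<open>Measurability of the labelling and the probability\<close>

text \<open>A coordinate outside \<open>I\<close> is constantly \<open>undefined\<close> on the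
  product space. The total version avoids tracking which boxes exist.\<close>

lemma measurable_PiM_component_total:
  "(\<lambda>x. x b) \<in> borel_measurable (\<Pi>\<^sub>M b\<in>I. unif)"
proof (cases "b \<in> I")
  case True
  then show ?thesis
    using measurable_component_singleton[OF True, of "\<lambda>_. unif"] by (simp cong: measurable_cong_sets)
next
  case False
  have "(\<lambda>_. undefined :: real) \<in> borel_measurable (\<Pi>\<^sub>M b\<in>I. unif)" by (rule borel_measurable_const)
  moreover have "(\<lambda>x. x b) \<in> borel_measurable (\<Pi>\<^sub>M b\<in>I. unif) \<longleftrightarrow>
      (\<lambda>_. undefined :: real) \<in> borel_measurable (\<Pi>\<^sub>M b\<in>I. unif)"
    using False by (intro measurable_cong) (auto simp: space_PiM)
  ultimately show ?thesis by blast
qed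

text \<open>The choice made by \<open>arg_min_on\<close> depends on \<open>x\<close> only through
  the set \<open>A x\<close> of minimisers, which has finitely many possible values, each cut out by
  comparisons. Ties therefore cause no trouble.\<close>

lemma measurable_first_right:
  assumes U: "finite U" and y: "\<And>j. (\<lambda>x. y x j) \<in> borel_measurable M" and c: "c \<in> borel_measurable M"
  shows "(\<lambda>x. first_right (y x) (c x) U) \<in> measurable M (count_space UNIV)"
proof -
  define A where "A x = {j\<in>U. \<forall>k\<in>U. frac (y x j - c x) \<le> frac (y x k - c x)}" for x
  have fr: "first_right (y x) (c x) U = (SOME j. j \<in> A x)" for x
    unfolding first_right_def arg_min_on_def arg_min_def is_arg_min_def A_def
    by (intro arg_cong[of _ _ Eps]) (auto simp: fun_eq_iff not_less)
  have frac: "(\<lambda>x. frac (y x j - c x)) \<in> borel_measurable M" for j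
    unfolding frac_def using y[of j] c by measurable
  have le: "Measurable.pred M (\<lambda>x. frac (y x j - c x) \<le> frac (y x k - c x))" for j k
    unfolding pred_def by (intro borel_measurable_le frac)
  have "Measurable.pred M (\<lambda>x. first_right (y x) (c x) U = a)" for a
  proof -
    have "first_right (y x) (c x) U = a \<longleftrightarrow> (\<exists>S\<in>{S. S \<subseteq> U \<and> (SOME j. j \<in> S) = a}.
        \<forall>j\<in>U. (j \<in> S) = (\<forall>k\<in>U. frac (y x j - c x) \<le> frac (y x k - c x)))" (is "_ \<longleftrightarrow> ?R") for x
    proof
      assume "first_right (y x) (c x) U = a"
      then show ?R unfolding fr by (intro bexI[of _ "A x"]) (auto simp: A_def)
    next
      assume ?R
      then obtain S where S: "S \<subseteq> U" "(SOME j. j \<in> S) = a"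
        "\<forall>j\<in>U. (j \<in> S) = (\<forall>k\<in>U. frac (y x j - c x) \<le> frac (y x k - c x))" by blast
      then have "S = A x" unfolding A_def by blast
      with S(2) show "first_right (y x) (c x) U = a" unfolding fr by simp
    qed
    moreover have "finite {S. S \<subseteq> U \<and> (SOME j. j \<in> S) = a}" using U by simp
    then have "Measurable.pred M (\<lambda>x. \<exists>S\<in>{S. S \<subseteq> U \<and> (SOME j. j \<in> S) = a}.
        \<forall>j\<in>U. (j \<in> S) = (\<forall>k\<in>U. frac (y x j - c x) \<le> frac (y x k - c x)))"
      by (intro pred_intros_finite(3,4) pred_intros_logic(6) measurable_const U le) auto
    ultimately show ?thesis by simp
  qed
  then have "(\<lambda>x. first_right (y x) (c x) U) -` {a} \<inter> space M \<in> sets M" for a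
    unfolding pred_def by (simp only: vimage_def Int_def mem_Collect_eq singleton_iff conj_commute)
  then show ?thesis
    unfolding measurable_count_space_eq2_countable by simp
qed

text \<open>The boxes \<open>bs\<close> of the row above are held fixed here; the random list is
  substituted afterwards, which is allowed because lists of naturals form a countable type.\<close>

lemma measurable_label_row:
  assumes "finite U"
  shows "(\<lambda>x. label_row (\<lambda>j. x (i, j)) (map (\<lambda>j. x (k, j)) bs) U)
    \<in> measurable (\<Pi>\<^sub>M b\<in>I. unif) (count_space UNIV)"
  using assms
proof (induction bs arbitrary: U)
  case (Cons b bs)
  have "(\<lambda>x. (\<lambda>a x. a # label_row (\<lambda>j. x (i, j)) (map (\<lambda>j. x (k, j)) bs) (U - {a}))
      (first_right (\<lambda>j. x (i, j)) (x (k, b)) U) x) \<in> measurable (\<Pi>\<^sub>M b\<in>I. unif) (count_space UNIV)"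
  proof (rule measurable_compose_countable[where f = "\<lambda>a x. a # label_row (\<lambda>j. x (i, j)) (map (\<lambda>j. x (k, j)) bs) (U - {a})"])
    fix a
    show "(\<lambda>x. a # label_row (\<lambda>j. x (i, j)) (map (\<lambda>j. x (k, j)) bs) (U - {a}))
        \<in> measurable (\<Pi>\<^sub>M b\<in>I. unif) (count_space UNIV)"
      using Cons by (intro measurable_compose[OF Cons.IH[of "U - {a}"], of "\<lambda>l. a # l"]) auto
  next
    show "(\<lambda>x. first_right (\<lambda>j. x (i, j)) (x (k, b)) U) \<in> measurable (\<Pi>\<^sub>M b\<in>I. unif) (count_space UNIV)"
      using Cons.prems by (intro measurable_first_right measurable_PiM_component_total)
  qed
  then show ?case by simp
qed simp

lemma measurable_boxes_by_label:
  "(\<lambda>x. boxes_by_label x i) \<in> measurable (\<Pi>\<^sub>M b\<in>I. unif) (count_space UNIV)"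
proof (induction i)
  case (Suc i)
  have "(\<lambda>x. (\<lambda>bs x. label_row (\<lambda>j. x (Suc i, j)) (map (\<lambda>j. x (i, j)) bs) {1..Suc i}) (boxes_by_label x i) x)
      \<in> measurable (\<Pi>\<^sub>M b\<in>I. unif) (count_space UNIV)"
    by (rule measurable_compose_countable[OF measurable_label_row Suc]) simp
  then show ?case by simp
qed simp

lemma sets_row_word_eq_rev:
  "{x \<in> space (\<Pi>\<^sub>M b\<in>I. unif). row_word x n = rev [1..<Suc n]} \<in> sets (\<Pi>\<^sub>M b\<in>I. unif)"
proof -
  have "Measurable.pred (\<Pi>\<^sub>M b\<in>I. unif) (\<lambda>x. sorted_wrt (>) (map (\<lambda>j. x (n, j)) bs))" for bs
  proof (induction bs)
    case (Cons b bs)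
    have "Measurable.pred (\<Pi>\<^sub>M b\<in>I. unif) (\<lambda>x. x (n, j) < x (n, b))" for j
      unfolding pred_def by (intro borel_measurable_less measurable_PiM_component_total)
    then have "Measurable.pred (\<Pi>\<^sub>M b\<in>I. unif)
        (\<lambda>x. (\<forall>j\<in>set bs. x (n, j) < x (n, b)) \<and> sorted_wrt (>) (map (\<lambda>j. x (n, j)) bs))"
      using Cons by (intro pred_intros_logic(3) pred_intros_finite(3)) auto
    then show ?case by simp
  qed simp
  then have "Measurable.pred (\<Pi>\<^sub>M b\<in>I. unif)
      (\<lambda>x. (\<lambda>bs x. sorted_wrt (>) (map (\<lambda>j. x (n, j)) bs)) (boxes_by_label x n) x)"
    by (rule measurable_compose_countable[OF _ measurable_boxes_by_label])
  then show ?thesis unfolding row_word_eq_rev_iff pred_def .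
qed

text \<open>A level set is either empty or equal to the level set at the largest value of
  \<open>x\<close> not exceeding \<open>s\<close>.\<close>

lemma all_levels_iff:
  fixes x :: "'a \<Rightarrow> real"
  assumes "finite B" "P {}"
  shows "(\<forall>s. P {b\<in>B. x b \<le> s}) \<longleftrightarrow> (\<forall>a\<in>B. P {b\<in>B. x b \<le> x a})"
proof (intro iffI allI)
  fix s assume *: "\<forall>a\<in>B. P {b\<in>B. x b \<le> x a}"
  show "P {b\<in>B. x b \<le> s}"
  proof (cases "{b\<in>B. x b \<le> s} = {}")
    case True
    then show ?thesis using assms by (simp only:)
  next
    case False
    let ?X = "x ` {b\<in>B. x b \<le> s}"
    have "Max ?X \<in> ?X" using False assms by (intro Max_in) auto
    then obtain a where a: "a \<in> B" "x a \<le> s" "x a = Max ?X" by auto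
    have "x b \<le> x a" if "b \<in> B" "x b \<le> s" for b
      unfolding a(3) using that assms by (intro Max_ge) auto
    then have "{b\<in>B. x b \<le> s} = {b\<in>B. x b \<le> x a}" using a(2) by force
    then show ?thesis using * a(1) by simp
  qed
qed simp

text \<open>For generic positions this identifies the reversal with the tests made by a growth
  event: interlacing at every real level reduces to interlacing at the box positions.\<close>

lemma row_word_eq_rev_iff_interlaced:
  assumes "inj_on x (boxes n)" "\<forall>b\<in>boxes n. x b \<in> {0..<1}"
  shows "row_word x n = rev [1..<Suc n] \<longleftrightarrow>
    (\<forall>a\<in>boxes n. interlaced n (row_count {b\<in>boxes n. x b \<le> x a}))"
proof -
  have rc: "row_count {b\<in>boxes n. x b \<le> s} i = card {j\<in>{1..i}. x (i, j) \<le> s}" if "i \<le> n" for i s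
    unfolding row_count_def using that by (intro arg_cong[of _ _ card]) (auto simp: boxes_def)
  have "row_word x n = rev [1..<Suc n] \<longleftrightarrow>
    (\<forall>i<n. \<forall>s. card {j\<in>{1..i}. x (i, j) \<le> s} \<le> card {j\<in>{1..Suc i}. x (Suc i, j) \<le> s} \<and>
       card {j\<in>{1..Suc i}. x (Suc i, j) \<le> s} \<le> Suc (card {j\<in>{1..i}. x (i, j) \<le> s}))"
    unfolding row_word_eq_rev_iff
    using assms by (intro boxes_by_label_decreasing_iff[where n = n]) auto
  also have "\<dots> \<longleftrightarrow> (\<forall>s. interlaced n (row_count {b\<in>boxes n. x b \<le> s}))"
    unfolding interlaced_def by (auto simp: rc)
  also have "\<dots> \<longleftrightarrow> (\<forall>a\<in>boxes n. interlaced n (row_count {b\<in>boxes n. x b \<le> x a}))"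
    by (rule all_levels_iff) (simp_all add: finite_boxes interlaced_def row_count_def)
  finally show ?thesis .
qed

lemma interlacing_weight_boxes:
  "interlacing_weight n (row_count (boxes n)) = 1 / (\<Prod>k=1..n-1. real ((2 * k + 1) choose (k + 1)))"
proof -
  have "interlaced n (row_count (boxes n))" by (simp add: interlaced_def row_count_boxes)
  moreover have "strict_parts n (row_count (boxes n)) = {1..n}"
    by (auto simp: strict_parts_def row_count_boxes Suc_diff_le)
  moreover have "(\<Prod>i=1..n. fact (row_count (boxes n) i) :: real) = (\<Prod>i=1..n. fact i)"
    by (intro prod.cong) (auto simp: row_count_boxes)
  ultimately show ?thesis using shifted_weight_staircase[of n] by (simp add: interlacing_weight_def)
qed

theorem theoremT:
  fixes n :: nat
  assumes "n \<ge> 2"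
  shows "measure (random_mlq n) {x \<in> space (random_mlq n). row_word x n = rev [1..<Suc n]}
    = 1 / (\<Prod>k=1..n-1. real ((2 * k + 1) choose (k + 1)))"
proof -
  let ?G = "\<lambda>S. interlaced n (row_count S)"
  let ?f = "\<lambda>S. interlacing_weight n (row_count S)"
  let ?E = "{x \<in> space (random_mlq n). row_word x n = rev [1..<Suc n]}"
  let ?K = "growth_event ?G (boxes n) 1"
  have "AE x in random_mlq n. (\<forall>b\<in>boxes n. x b \<in> {0..<1}) \<and> inj_on x (boxes n)"
    unfolding random_mlq_def by (rule AE_distinct_unif[OF finite_boxes])
  \<comment> \<open>The two events are compared only where positions are distinct and lie in the
    unit interval, which is almost everywhere.\<close>
  then have "AE x in random_mlq n. x \<in> ?E \<longleftrightarrow> x \<in> ?K"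
  proof (rule AE_mp, intro AE_I2 impI)
    fix x assume x: "x \<in> space (random_mlq n)" "(\<forall>b\<in>boxes n. x b \<in> {0..<1}) \<and> inj_on x (boxes n)"
    then have "x \<in> ?K \<longleftrightarrow> (\<forall>a\<in>boxes n. ?G {b\<in>boxes n. x b \<le> x a})"
      unfolding growth_event_def random_mlq_def by (auto dest: inj_onD)
    then show "x \<in> ?E \<longleftrightarrow> x \<in> ?K" using row_word_eq_rev_iff_interlaced[of x n] x by simp
  qed
  then have "measure (random_mlq n) ?E = measure (random_mlq n) ?K"
    by (rule measure_eq_AE)
       (simp_all only: random_mlq_def sets_row_word_eq_rev sets_growth_event[OF finite_boxes])
  \<comment> \<open>At \<open>t = 1\<close> the power of \<open>t\<close> is 1, leaving only the
    weight of the full set of boxes.\<close>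
  also have "emeasure (random_mlq n) ?K = ennreal (?f (boxes n) * 1 ^ card (boxes n))"
    unfolding random_mlq_def
  proof (rule emeasure_growth_event[OF finite_boxes, where f = ?f])
    show "?f {} = 1"
      by (simp add: interlacing_weight_def interlaced_def strict_parts_def row_count_def shifted_weight_def)
  qed (auto simp: interlacing_weight_nonneg interlacing_weight_boxes_recursion, simp add: interlacing_weight_def)
  then have "measure (random_mlq n) ?K = ?f (boxes n)"
    by (simp add: measure_def interlacing_weight_nonneg)
  also note interlacing_weight_boxes
  finally show ?thesis .
qed

end
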